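(* Let $\gamma:I\to\mathcal{HH}_3$ be a non-null curve parametrized by arclength, with Frenet frame $\{T,N,B\}$, geodesic curvature $k_1$ and geodesic torsion $k_2$. Then $\gamma$ is a non-geodesic biharmonic curve if and only if $$k_1=\text{constant}\neq0,\qquad k_1^2\varepsilon_1\varepsilon_3+k_2^2=1+4\varepsilon_3B_3^2,\qquad k_2'=N_3B_3 .$$
   Context: $\mathcal{HH}_3=(\mathbb{R}^3,g)$ is the 3-dimensional hyperbolic Heisenberg group with the semi-Riemannian metric $g=(dx)^2-(dy)^2-\frac14(dz+2y\,dx-2x\,dy)^2$ and Levi-Civita connection $\nabla$. The frame $e_1=\partial_x-2y\,\partial_z$, $e_2=\partial_y+2x\,\partial_z$, $e_3=2\,\partial_z$ is orthonormal, with $g(e_1,e_1)=1$, $g(e_2,e_2)=g(e_3,e_3)=-1$. For $X=\sum a_ie_i$, $Y=\sum b_ie_i$ put $X\wedge Y=-(a_2b_3-a_3b_2)e_1-(a_1b_3-a_3b_1)e_2+(a_1b_2-a_2b_1)e_3$. Curvature: $R(X,Y)Z=\nabla_X\nabla_YZ-\nabla_Y\nabla_XZ-\nabla_{[X,Y]}Z$. Curves: $I$ is an open interval and $\gamma:I\to\mathcal{HH}_3$ is smooth. Non-null and parametrized by arclength means that $T=\gamma'$ satisfies $g(T,T)=\varepsilon_1$ constant, $\varepsilon_1\in\{1,-1\}$ (spacelike if $1$, timelike if $-1$). $\gamma$ is biharmonic if $\nabla_T\nabla_T\nabla_TT-R(T,\nabla_TT)T=0$. Standing assumption: $\nabla_TT$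 is nowhere zero ("non-geodesic") and nowhere null, so that the orthonormal Frenet frame $\{T,N,B\}$ is defined: $k_1=|g(\nabla_TT,\nabla_TT)|^{1/2}$, $N$ is the unit vector field with $\nabla_TT=k_1\varepsilon_2N$, $B=T\wedge N$, where $\varepsilon_2=g(N,N)$, $\varepsilon_3=g(B,B)$; and $k_2$ is defined by the Frenet equations $\nabla_TN=-k_1\varepsilon_1T+k_2\varepsilon_3B$, $\nabla_TB=-k_2\varepsilon_2N$. $N_3$ and $B_3$ are the $e_3$-components of $N=\sum N_ie_i$ and $B=\sum B_ie_i$; primes denote $d/ds$. *)

theory Defs
  imports "HOL-Analysis.Analysis"
begin

section \<open>Semi-Riemannian metrics on the coordinate space\<close>

text \<open>A metric assigns to each point of $\mathbb{R}^3$ a bilinear form on the tangent space, which is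
  identified with \<open>real^3\<close> through the coordinate basis $\partial_x, \partial_y, \partial_z$.\<close>

type_synonym metric3 = "real^3 \<Rightarrow> real^3 \<Rightarrow> real^3 \<Rightarrow> real"
type_synonym vfield3 = "real^3 \<Rightarrow> real^3"

definition gram :: "metric3 \<Rightarrow> real^3 \<Rightarrow> real^3^3" where
  "gram g p = (\<chi> i j. g p (axis i 1) (axis j 1))"

definition partial_deriv :: "3 \<Rightarrow> (real^3 \<Rightarrow> real) \<Rightarrow> real^3 \<Rightarrow> real" where
  "partial_deriv i f p = frechet_derivative f (at p) (axis i 1)"

text \<open>\<open>christoffel g k i j\<close> is the symbol $\Gamma^k_{ij}$ of the Levi-Civita connection of \<open>g\<close> in these coordinates.\<close>

definition christoffel :: "metric3 \<Rightarrow> 3 \<Rightarrow> 3 \<Rightarrow> 3 \<Rightarrow> real^3 \<Rightarrow> real" where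
  "christoffel g k i j p = (1/2) * (\<Sum>l\<in>UNIV. matrix_inv (gram g p) $ k $ l *
      (partial_deriv i (\<lambda>q. gram g q $ j $ l) p
     + partial_deriv j (\<lambda>q. gram g q $ i $ l) p
     - partial_deriv l (\<lambda>q. gram g q $ i $ j) p))"

definition christoffel_term :: "metric3 \<Rightarrow> real^3 \<Rightarrow> real^3 \<Rightarrow> real^3 \<Rightarrow> real^3" where
  "christoffel_term g p u v =
     (\<chi> k. \<Sum>i\<in>UNIV. \<Sum>j\<in>UNIV. christoffel g k i j p * u $ i * v $ j)"

definition levi_civita :: "metric3 \<Rightarrow> vfield3 \<Rightarrow> vfield3 \<Rightarrow> vfield3" where
  "levi_civita g X Y p = frechet_derivative Y (at p) (X p) + christoffel_term g p (X p) (Y p)"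

definition lie_bracket :: "vfield3 \<Rightarrow> vfield3 \<Rightarrow> vfield3" where
  "lie_bracket X Y p = frechet_derivative Y (at p) (X p) - frechet_derivative X (at p) (Y p)"

definition curvature_field :: "metric3 \<Rightarrow> vfield3 \<Rightarrow> vfield3 \<Rightarrow> vfield3 \<Rightarrow> vfield3" where
  "curvature_field g X Y Z p =
     levi_civita g X (levi_civita g Y Z) p
   - levi_civita g Y (levi_civita g X Z) p
   - levi_civita g (lie_bracket X Y) Z p"

text \<open>The curvature is a tensor, so its value on tangent vectors at \<open>p\<close> may be computed from any
  smooth vector fields extending them; the ones with constant coordinates are used.\<close>

definition curvature :: "metric3 \<Rightarrow> real^3 \<Rightarrow> real^3 \<Rightarrow> real^3 \<Rightarrow> real^3 \<Rightarrow> real^3" where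
  "curvature g p u v w = curvature_field g (\<lambda>_. u) (\<lambda>_. v) (\<lambda>_. w) p"

section \<open>Curves\<close>

definition velocity :: "(real \<Rightarrow> real^3) \<Rightarrow> real \<Rightarrow> real^3" where
  "velocity c s = vector_derivative c (at s)"

definition smooth_curve_on :: "real set \<Rightarrow> (real \<Rightarrow> real^3) \<Rightarrow> bool" where
  "smooth_curve_on I c \<longleftrightarrow> (\<forall>n. \<forall>s\<in>I. (velocity ^^ n) c differentiable (at s))"

text \<open>Covariant derivative $\nabla_T V$ of a vector field \<open>V\<close> along the curve \<open>c\<close>, where $T = c'$.\<close>

definition cov_deriv :: "metric3 \<Rightarrow> (real \<Rightarrow> real^3) \<Rightarrow> (real \<Rightarrow> real^3) \<Rightarrow> real \<Rightarrow> real^3" where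
  "cov_deriv g c V s = vector_derivative V (at s) + christoffel_term g (c s) (velocity c s) (V s)"

definition nongeodesic_on :: "metric3 \<Rightarrow> real set \<Rightarrow> (real \<Rightarrow> real^3) \<Rightarrow> bool" where
  "nongeodesic_on g I c \<longleftrightarrow> (\<forall>s\<in>I. cov_deriv g c (velocity c) s \<noteq> 0)"

definition biharmonic_on :: "metric3 \<Rightarrow> real set \<Rightarrow> (real \<Rightarrow> real^3) \<Rightarrow> bool" where
  "biharmonic_on g I c \<longleftrightarrow>
     (\<forall>s\<in>I. cov_deriv g c (cov_deriv g c (cov_deriv g c (velocity c))) s
       - curvature g (c s) (velocity c s) (cov_deriv g c (velocity c) s) (velocity c s) = 0)"

section \<open>The hyperbolic Heisenberg group\<close>

definition hh3 :: metric3 where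
  "hh3 p u v = u $ 1 * v $ 1 - u $ 2 * v $ 2
     - (1/4) * (u $ 3 + 2 * p $ 2 * u $ 1 - 2 * p $ 1 * u $ 2)
             * (v $ 3 + 2 * p $ 2 * v $ 1 - 2 * p $ 1 * v $ 2)"

definition e1 :: vfield3 where "e1 p = vector [1, 0, - 2 * p $ 2]"
definition e2 :: vfield3 where "e2 p = vector [0, 1, 2 * p $ 1]"
definition e3 :: vfield3 where "e3 p = vector [0, 0, 2]"

definition frame_coords :: "real^3 \<Rightarrow> real^3 \<Rightarrow> real^3" where
  "frame_coords p v =
     (THE a. v = a $ 1 *\<^sub>R e1 p + a $ 2 *\<^sub>R e2 p + a $ 3 *\<^sub>R e3 p)"

lemma frame_coords_eq:
  "frame_coords p v = vector [v $ 1, v $ 2, (v $ 3 + 2 * p $ 2 * v $ 1 - 2 * p $ 1 * v $ 2) / 2]"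
  unfolding frame_coords_def
  by (rule the_equality) (auto simp: e1_def e2_def e3_def vec_eq_iff forall_3 field_simps)

lemma frame_orthonormal:
  "hh3 p (e1 p) (e1 p) = 1" "hh3 p (e2 p) (e2 p) = -1" "hh3 p (e3 p) (e3 p) = -1"
  "hh3 p (e1 p) (e2 p) = 0" "hh3 p (e1 p) (e3 p) = 0" "hh3 p (e2 p) (e3 p) = 0"
  by (simp_all add: hh3_def e1_def e2_def e3_def)

definition wedge :: "real^3 \<Rightarrow> real^3 \<Rightarrow> real^3 \<Rightarrow> real^3" where
  "wedge p u v = (let a = frame_coords p u; b = frame_coords p v in
     - (a $ 2 * b $ 3 - a $ 3 * b $ 2) *\<^sub>R e1 p
     - (a $ 1 * b $ 3 - a $ 3 * b $ 1) *\<^sub>R e2 p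
     + (a $ 1 * b $ 2 - a $ 2 * b $ 1) *\<^sub>R e3 p)"

text \<open>A smooth curve of unit speed and causal character \<open>\<epsilon>1\<close> on \<open>I\<close>.\<close>

definition nonnull_arclength_curve :: "real set \<Rightarrow> (real \<Rightarrow> real^3) \<Rightarrow> real \<Rightarrow> bool" where
  "nonnull_arclength_curve I c \<epsilon>1 \<longleftrightarrow>
     smooth_curve_on I c \<and> \<epsilon>1 \<in> {1, -1} \<and>
     (\<forall>s\<in>I. hh3 (c s) (velocity c s) (velocity c s) = \<epsilon>1)"

text \<open>The Frenet data of \<open>c\<close>, for which $\nabla_T T$ must be nowhere zero and nowhere null.
  All of them are determined on \<open>I\<close> by \<open>c\<close>; in particular \<open>k2\<close> is the function for which the
  Frenet equations (the last two conjuncts) hold.\<close>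

definition frenet_apparatus ::
  "real set \<Rightarrow> (real \<Rightarrow> real^3) \<Rightarrow> real \<Rightarrow> real \<Rightarrow> real \<Rightarrow> (real \<Rightarrow> real) \<Rightarrow> (real \<Rightarrow> real)
    \<Rightarrow> (real \<Rightarrow> real^3) \<Rightarrow> (real \<Rightarrow> real^3) \<Rightarrow> bool" where
  "frenet_apparatus I c \<epsilon>1 \<epsilon>2 \<epsilon>3 k1 k2 N B \<longleftrightarrow>
     \<epsilon>2 \<in> {1, -1} \<and> \<epsilon>3 \<in> {1, -1} \<and>
     (\<forall>s\<in>I.
        let T = velocity c; A = cov_deriv hh3 c T in
          A s \<noteq> 0 \<and> hh3 (c s) (A s) (A s) \<noteq> 0 \<and>
          k1 s = sqrt \<bar>hh3 (c s) (A s) (A s)\<bar> \<and>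
          hh3 (c s) (N s) (N s) = \<epsilon>2 \<and>
          A s = (k1 s * \<epsilon>2) *\<^sub>R N s \<and>
          B s = wedge (c s) (T s) (N s) \<and>
          hh3 (c s) (B s) (B s) = \<epsilon>3 \<and>
          cov_deriv hh3 c N s = - (k1 s * \<epsilon>1) *\<^sub>R T s + (k2 s * \<epsilon>3) *\<^sub>R B s \<and>
          cov_deriv hh3 c B s = - (k2 s * \<epsilon>2) *\<^sub>R N s)"

end

theory Submission
  imports Defs
begin

text \<open>The orthonormal frame $e_1, e_2, e_3$ is left-invariant, so in frame coordinates the metric, the
  connection and the curvature have constant coefficients. Expanding the bitension field in the
  Frenet frame, its $T$-, $N$- and $B$-components give $k_1' = 0$, the second condition of the theorem
  and $k_2' = 4 \varepsilon_1 N_3 B_3$. The factor $4 \varepsilon_1$ does not matter: since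
  $B_3' = N_3 (\varepsilon_1 - \varepsilon_2 k_2)$, differentiating the second condition
  under $k_2' = m N_3 B_3$ gives $N_3 B_3 ((m + 4 \varepsilon_1) k_2 - 4 \varepsilon_2) = 0$.
  Hence $k_2$ is locally constant wherever $N_3 B_3 \neq 0$, which contradicts $k_2' = m N_3 B_3$;
  so $N_3 B_3$ and $k_2'$ vanish identically for $m = 1$ as well as for $m = 4 \varepsilon_1$.\<close>

section \<open>Geometry in the left-invariant frame\<close>

definition fmetric :: "real^3 \<Rightarrow> real^3 \<Rightarrow> real" where
  "fmetric u v = u $ 1 * v $ 1 - u $ 2 * v $ 2 - u $ 3 * v $ 3"

text \<open>The Lorentzian cross product: its \<open>fmetric\<close> product with \<open>w\<close>
  is minus the determinant of \<open>u\<close>, \<open>v\<close>, \<open>w\<close>, which fixes the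
  signs.\<close>

definition fwedge :: "real^3 \<Rightarrow> real^3 \<Rightarrow> real^3" where
  "fwedge u v = vector [- (u $ 2 * v $ 3 - u $ 3 * v $ 2), - (u $ 1 * v $ 3 - u $ 3 * v $ 1),
     u $ 1 * v $ 2 - u $ 2 * v $ 1]"

text \<open>\<open>fconn u v\<close> is $\sum_{i,j} u_i v_j \nabla_{e_i} e_j$; the Koszul formula computes it from
  $[e_1, e_2] = 2 e_3$ and $[e_1, e_3] = [e_2, e_3] = 0$.\<close>

definition fconn :: "real^3 \<Rightarrow> real^3 \<Rightarrow> real^3" where
  "fconn u v = vector [- (u $ 2 * v $ 3 + u $ 3 * v $ 2), - (u $ 1 * v $ 3 + u $ 3 * v $ 1),
     u $ 1 * v $ 2 - u $ 2 * v $ 1]"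

text \<open>The first two terms are the curvature of a space form of curvature 1.\<close>

definition fcurv :: "real^3 \<Rightarrow> real^3 \<Rightarrow> real^3 \<Rightarrow> real^3" where
  "fcurv u v w = fmetric v w *\<^sub>R u - fmetric u w *\<^sub>R v
     + (4 * (u $ 1 * v $ 2 - u $ 2 * v $ 1)) *\<^sub>R vector [w $ 2, w $ 1, 0]"

section \<open>Passage from coordinate vectors to frame components\<close>

lemma frame_coords_nth [simp]:
  "frame_coords p v $ 1 = v $ 1" "frame_coords p v $ 2 = v $ 2"
  "frame_coords p v $ 3 = (v $ 3 + 2 * p $ 2 * v $ 1 - 2 * p $ 1 * v $ 2) / 2"
  by (simp_all add: frame_coords_eq)

lemma frame_coords_linear: "linear (frame_coords p)"
  by (rule linearI) (simp_all add: vec_eq_iff forall_3 field_simps)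

lemma frame_coords_inject: "frame_coords p u = frame_coords p v \<longleftrightarrow> u = v"
  by (auto simp: vec_eq_iff forall_3)

lemma hh3_frame: "hh3 p u v = fmetric (frame_coords p u) (frame_coords p v)"
  by (simp add: hh3_def fmetric_def field_simps)

lemma frame_coords_wedge:
  "frame_coords p (wedge p u v) = fwedge (frame_coords p u) (frame_coords p v)"
  by (simp add: vec_eq_iff forall_3 wedge_def fwedge_def Let_def e1_def e2_def e3_def field_simps)

section \<open>Christoffel symbols of the metric\<close>

lemma matrix_inv_eqI:
  fixes A M :: "real^'n^'n"
  assumes "A ** M = mat 1" "M ** A = mat 1"
  shows "matrix_inv A = M"
proof -
  \<comment> \<open>\<open>matrix_inv\<close> is a choice; \<open>M\<close> witnesses that there is
    something to choose.\<close>
  have "A ** matrix_inv A = mat 1"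
    unfolding matrix_inv_def using someI[of "\<lambda>M. A ** M = mat 1 \<and> M ** A = mat 1" M] assms by blast
  then have "M ** (A ** matrix_inv A) = M" by simp
  then show ?thesis by (simp add: matrix_mul_assoc assms)
qed

text \<open>The inverse metric is read off from the orthonormal frame: the square of
  \<open>e1\<close> minus the squares of \<open>e2\<close> and \<open>e3\<close>, as symmetric
  tensors.\<close>

lemma matrix_inv_gram_hh3:
  "matrix_inv (gram hh3 p) = vector [vector [1, 0, - 2 * p $ 2], vector [0, - 1, - 2 * p $ 1],
     vector [- 2 * p $ 2, - 2 * p $ 1, 4 * (p $ 2)\<^sup>2 - 4 * (p $ 1)\<^sup>2 - 4]]"
  by (rule matrix_inv_eqI)
    (simp_all add: vec_eq_iff forall_3 matrix_matrix_mult_def sum_3 gram_def hh3_def axis_def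
        mat_def power2_eq_square field_simps)

text \<open>For fixed \<open>u\<close> and \<open>v\<close> the base point enters only through the
  product of the third frame components, so this is the product rule for it.\<close>

lemma hh3_has_derivative:
  "((\<lambda>q. hh3 q u v) has_derivative (\<lambda>h. - (h $ 2 * u $ 1 - h $ 1 * u $ 2) * frame_coords p v $ 3
     - frame_coords p u $ 3 * (h $ 2 * v $ 1 - h $ 1 * v $ 2))) (at p)"
  unfolding hh3_def
  by (auto intro!: derivative_eq_intros bounded_linear.has_derivative[OF bounded_linear_vec_nth]
      simp: field_simps)

lemma partial_deriv_gram_hh3:
  "partial_deriv l (\<lambda>q. gram hh3 q $ i $ j) p =
     - (axis l 1 $ 2 * axis i 1 $ 1 - axis l 1 $ 1 * axis i 1 $ 2) * frame_coords p (axis j 1) $ 3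
     - frame_coords p (axis i 1) $ 3 * (axis l 1 $ 2 * axis j 1 $ 1 - axis l 1 $ 1 * axis j 1 $ 2)"
  unfolding partial_deriv_def gram_def
  by (simp add: frechet_derivative_at[OF hh3_has_derivative, symmetric])

text \<open>The vector has frame components a, b, 0. The first two are those of
  \<open>fconn\<close>; the antisymmetric third component of \<open>fconn\<close> arises only when
  the frame itself is differentiated.\<close>

lemma christoffel_term_hh3:
  "christoffel_term hh3 p u v =
     (let a = - (u $ 2 * frame_coords p v $ 3 + frame_coords p u $ 3 * v $ 2);
          b = - (u $ 1 * frame_coords p v $ 3 + frame_coords p u $ 3 * v $ 1)
      in vector [a, b, 2 * p $ 1 * b - 2 * p $ 2 * a])"
  by (simp add: christoffel_term_def christoffel_def matrix_inv_gram_hh3 partial_deriv_gram_hh3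
      vec_eq_iff forall_3 sum_3 axis_def Let_def power2_eq_square field_simps)

lemma vector_3_eq: "(vector [a, b, c] :: real^3) = a *\<^sub>R axis 1 1 + b *\<^sub>R axis 2 1 + c *\<^sub>R axis 3 1"
  by (simp add: vec_eq_iff forall_3 axis_def)

lemma differentiable_nth:
  fixes v :: "real \<Rightarrow> real^'n"
  assumes "v differentiable (at s)"
  shows "(\<lambda>s. v s $ i) differentiable (at s)"
  using assms unfolding differentiable_def
  by (blast intro: bounded_linear.has_derivative[OF bounded_linear_vec_nth])

lemma differentiable_vector_3:
  fixes f g h :: "real \<Rightarrow> real"
  assumes "f differentiable (at s)" "g differentiable (at s)" "h differentiable (at s)"
  shows "(\<lambda>s. vector [f s, g s, h s] :: real^3) differentiable (at s)"
  unfolding vector_3_eq using assms by (intro differentiable_add differentiable_scaleR differentiable_const)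

lemma vec3_has_vector_derivative:
  fixes f :: "real \<Rightarrow> real^3"
  assumes "((\<lambda>s. f s $ 1) has_real_derivative a) (at x)" "((\<lambda>s. f s $ 2) has_real_derivative b) (at x)"
    "((\<lambda>s. f s $ 3) has_real_derivative c) (at x)"
  shows "(f has_vector_derivative vector [a, b, c]) (at x)"
proof -
  have "f = (\<lambda>s. f s $ 1 *\<^sub>R axis 1 1 + f s $ 2 *\<^sub>R axis 2 1 + f s $ 3 *\<^sub>R axis 3 1)"
    by (simp add: fun_eq_iff vec_eq_iff forall_3 axis_def)
  then show ?thesis
    unfolding vector_3_eq by (rule ssubst) (auto intro!: derivative_eq_intros simp: assms)
qed

lemma has_vector_derivative_nth:
  assumes "(f has_vector_derivative f') F"
  shows "((\<lambda>s. f s $ i) has_real_derivative f' $ i) F"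
  using bounded_linear.has_vector_derivative[OF bounded_linear_vec_nth assms]
  by (simp add: has_real_derivative_iff_has_vector_derivative)

text \<open>For constant fields the covariant derivative is \<open>christoffel_term\<close>, so the
  curvature needs its derivative in the base point.\<close>

lemma christoffel_term_hh3_has_derivative:
  "((\<lambda>q. christoffel_term hh3 q u v) has_derivative (\<lambda>h.
     let dv = h $ 2 * v $ 1 - h $ 1 * v $ 2; du = h $ 2 * u $ 1 - h $ 1 * u $ 2;
         a = christoffel_term hh3 p u v $ 1; b = christoffel_term hh3 p u v $ 2;
         a' = - (u $ 2 * dv + du * v $ 2); b' = - (u $ 1 * dv + du * v $ 1)
     in vector [a', b', 2 * h $ 1 * b + 2 * p $ 1 * b' - 2 * h $ 2 * a - 2 * p $ 2 * a'])) (at p)"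
  unfolding christoffel_term_hh3 vector_3_eq Let_def
  by (auto intro!: derivative_eq_intros bounded_linear.has_derivative[OF bounded_linear_vec_nth]
      simp: fun_eq_iff vec_eq_iff forall_3 axis_def field_simps)

lemma levi_civita_const:
  "levi_civita g (\<lambda>_. u) (\<lambda>_. v) = (\<lambda>p. christoffel_term g p u v)"
  by (simp add: levi_civita_def fun_eq_iff frechet_derivative_const)

text \<open>Constant coordinate fields commute, so the bracket term is zero and the rest is a
  polynomial identity in the coordinates.\<close>

lemma frame_coords_curvature:
  "frame_coords p (curvature hh3 p u v w) =
     fcurv (frame_coords p u) (frame_coords p v) (frame_coords p w)"
proof -
  have "lie_bracket (\<lambda>_. u) (\<lambda>_. v) = (\<lambda>_. 0)"
    by (simp add: lie_bracket_def fun_eq_iff frechet_derivative_const)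
  then show ?thesis
    unfolding curvature_def curvature_field_def levi_civita_const
    unfolding levi_civita_def frechet_derivative_at[OF christoffel_term_hh3_has_derivative, symmetric]
    by (simp add: levi_civita_const Let_def vec_eq_iff forall_3 christoffel_term_hh3
        fcurv_def fmetric_def field_simps)
qed

section \<open>The covariant derivative along a curve in frame components\<close>

definition fcov :: "(real \<Rightarrow> real^3) \<Rightarrow> (real \<Rightarrow> real^3) \<Rightarrow> real \<Rightarrow> real^3" where
  "fcov t v s = vector_derivative v (at s) + fconn (t s) (v s)"

text \<open>Only the third frame component depends on the base point; the extra vector is its rate
  of change as the base point moves.\<close>

lemma frame_coords_has_vector_derivative:
  assumes "(c has_vector_derivative c') (at s)" "(V has_vector_derivative V') (at s)"
  shows "((\<lambda>s. frame_coords (c s) (V s)) has_vector_derivative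
     frame_coords (c s) V' + vector [0, 0, c' $ 2 * V s $ 1 - c' $ 1 * V s $ 2]) (at s)"
proof -
  note d = assms[THEN has_vector_derivative_nth]
  have "((\<lambda>s. frame_coords (c s) (V s)) has_vector_derivative
     vector [V' $ 1, V' $ 2, (V' $ 3 + 2 * (c' $ 2 * V s $ 1 + c s $ 2 * V' $ 1)
        - 2 * (c' $ 1 * V s $ 2 + c s $ 1 * V' $ 2)) / 2]) (at s)"
    by (rule vec3_has_vector_derivative) (auto intro!: derivative_eq_intros d)
  then show ?thesis
    by (rule has_vector_derivative_eq_rhs) (simp add: vec_eq_iff forall_3 field_simps)
qed

lemma differentiable_of_frame_coords:
  fixes c V :: "real \<Rightarrow> real^3"
  assumes "c differentiable at s" "(\<lambda>s. frame_coords (c s) (V s)) differentiable at s"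
  shows "V differentiable at s"
proof -
  note c = assms(1)[THEN differentiable_nth] and F = assms(2)[THEN differentiable_nth]
  have "V = (\<lambda>s. vector [frame_coords (c s) (V s) $ 1, frame_coords (c s) (V s) $ 2,
      2 * frame_coords (c s) (V s) $ 3 - 2 * c s $ 2 * frame_coords (c s) (V s) $ 1
      + 2 * c s $ 1 * frame_coords (c s) (V s) $ 2])"
    by (simp add: fun_eq_iff vec_eq_iff forall_3 field_simps)
  then show ?thesis
    by (rule ssubst) (intro differentiable_vector_3 derivative_intros c F)
qed

text \<open>The moving frame contributes minus the third component of \<open>fconn\<close>, so
  adding \<open>fconn\<close> leaves exactly the Christoffel term.\<close>

lemma frame_coords_cov_deriv:
  assumes c: "c differentiable at s" and v: "(\<lambda>s. frame_coords (c s) (V s)) differentiable at s"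
  shows "frame_coords (c s) (cov_deriv hh3 c V s) =
     fcov (\<lambda>s. frame_coords (c s) (velocity c s)) (\<lambda>s. frame_coords (c s) (V s)) s"
proof -
  have "V differentiable at s"
    using assms by (rule differentiable_of_frame_coords)
  then have "(V has_vector_derivative vector_derivative V (at s)) (at s)"
    "(c has_vector_derivative velocity c s) (at s)"
    using c by (simp_all add: velocity_def vector_derivative_works)
  then have "vector_derivative (\<lambda>s. frame_coords (c s) (V s)) (at s) =
    frame_coords (c s) (vector_derivative V (at s)) +
      vector [0, 0, velocity c s $ 2 * V s $ 1 - velocity c s $ 1 * V s $ 2]"
    by (intro vector_derivative_at frame_coords_has_vector_derivative)
  then show ?thesis
    by (simp add: fcov_def cov_deriv_def fconn_def vec_eq_iff forall_3 christoffel_term_hh3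
        Let_def field_simps)
qed

lemma differentiable_cong_open:
  fixes f g :: "real \<Rightarrow> 'a::real_normed_vector"
  assumes "f differentiable at s" "open I" "s \<in> I" "\<And>x. x \<in> I \<Longrightarrow> f x = g x"
  shows "g differentiable at s"
  using assms has_derivative_transform_within_open unfolding differentiable_def by blast

section \<open>Algebra of the Lorentzian scalar and cross products\<close>

lemma fmetric_simps:
  "fmetric (u + v) w = fmetric u w + fmetric v w" "fmetric w (u + v) = fmetric w u + fmetric w v"
  "fmetric (r *\<^sub>R u) v = r * fmetric u v" "fmetric u (r *\<^sub>R v) = r * fmetric u v"
  "fmetric (u - v) w = fmetric u w - fmetric v w" "fmetric 0 v = 0"
  by (simp_all add: fmetric_def algebra_simps)

lemma fmetric_sym: "fmetric u v = fmetric v u"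
  by (simp add: fmetric_def)

lemma fmetric_differentiable:
  fixes u v :: "real \<Rightarrow> real^3"
  assumes "u differentiable (at s)" "v differentiable (at s)"
  shows "(\<lambda>s. fmetric (u s) (v s)) differentiable (at s)"
  unfolding fmetric_def using assms[THEN differentiable_nth] by (intro derivative_intros)

lemma fwedge_differentiable:
  fixes u v :: "real \<Rightarrow> real^3"
  assumes "u differentiable (at s)" "v differentiable (at s)"
  shows "(\<lambda>s. fwedge (u s) (v s)) differentiable (at s)"
  unfolding fwedge_def using assms[THEN differentiable_nth]
  by (intro differentiable_vector_3 derivative_intros)

lemma fmetric_fwedge: "fmetric (fwedge u v) u = 0" "fmetric (fwedge u v) v = 0"
  by (simp_all add: fmetric_def fwedge_def algebra_simps)

text \<open>Lagrange's identity; like the triple product expansion after it, it keeps its Euclidean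
  form in this signature.\<close>

lemma fmetric_fwedge_self:
  "fmetric (fwedge u v) (fwedge u v) = fmetric u u * fmetric v v - (fmetric u v)\<^sup>2"
  by (simp add: fmetric_def fwedge_def power2_eq_square algebra_simps)

lemma fwedge_fwedge: "fwedge u (fwedge v w) = fmetric u w *\<^sub>R v - fmetric u v *\<^sub>R w"
  by (simp add: fmetric_def fwedge_def vec_eq_iff forall_3 algebra_simps)

text \<open>By the triple product expansion, orthogonality to \<open>u\<close> and \<open>v\<close>
  gives a zero wedge of \<open>z\<close> with \<open>fwedge u v\<close>; wedging once more leaves a
  nonzero multiple of \<open>z\<close>.\<close>

lemma fmetric_eq_zeroI:
  assumes "fmetric z u = 0" "fmetric z v = 0" "fmetric z (fwedge u v) = 0"
    "fmetric (fwedge u v) (fwedge u v) \<noteq> 0"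
  shows "z = 0"
proof -
  have "fwedge z (fwedge u v) = 0"
    by (simp add: fwedge_fwedge assms)
  then have "fwedge (fwedge u v) (fwedge z (fwedge u v)) = 0"
    by (simp add: fwedge_def vec_eq_iff forall_3)
  then show ?thesis
    using assms by (simp add: fwedge_fwedge[of "fwedge u v"] fmetric_sym[of _ z])
qed

section \<open>Locality, Leibniz and metric rules for \<open>fcov\<close>\<close>

lemma fcov_eq: "(v has_vector_derivative v') (at s) \<Longrightarrow> fcov t v s = v' + fconn (t s) (v s)"
  by (simp add: fcov_def vector_derivative_at)

lemma bounded_bilinear_fconn: "bounded_bilinear fconn"
  unfolding bilinear_conv_bounded_bilinear[symmetric] bilinear_def
  by (auto intro!: linearI simp: fconn_def vec_eq_iff forall_3 algebra_simps)

text \<open>The Frenet expansions hold only on \<open>I\<close>; openness makes that enough for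
  differentiating them.\<close>

lemma fcov_cong_open:
  assumes "open I" "s \<in> I" "\<And>x. x \<in> I \<Longrightarrow> v x = w x"
  shows "fcov t v s = fcov t w s"
proof -
  have "eventually (\<lambda>x. v x = w x) (nhds s)"
    using assms by (auto simp: eventually_nhds)
  then show ?thesis
    using assms by (simp add: fcov_def vector_derivative_cong_eq)
qed

lemma frame_coords_cov_deriv_cong:
  assumes "open I" "s \<in> I" "c differentiable at s" "v differentiable at s"
    and eq: "\<And>x. x \<in> I \<Longrightarrow> frame_coords (c x) (V x) = v x"
  shows "frame_coords (c s) (cov_deriv hh3 c V s) = fcov (\<lambda>s. frame_coords (c s) (velocity c s)) v s"
proof -
  have "(\<lambda>s. frame_coords (c s) (V s)) differentiable at s"
    by (rule differentiable_cong_open[OF assms(4,1,2)]) (simp only: eq)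
  then show ?thesis
    using assms(3) fcov_cong_open[OF assms(1,2) eq] by (simp only: frame_coords_cov_deriv)
qed

lemma fcov_scaleR:
  assumes "(f has_real_derivative f') (at s)" "v differentiable at s"
  shows "fcov t (\<lambda>s. f s *\<^sub>R v s) s = f' *\<^sub>R v s + f s *\<^sub>R fcov t v s"
proof -
  have v: "(v has_vector_derivative vector_derivative v (at s)) (at s)"
    using assms(2) by (simp add: vector_derivative_works)
  show ?thesis
    unfolding fcov_eq[OF has_vector_derivative_scaleR[OF assms(1) v]]
    by (simp add: fcov_def vec_eq_iff forall_3 fconn_def algebra_simps)
qed

lemma fcov_add:
  fixes u v :: "real \<Rightarrow> real^3"
  assumes "u differentiable at s" "v differentiable at s"
  shows "fcov t (\<lambda>s. u s + v s) s = fcov t u s + fcov t v s"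
proof -
  note d = assms[unfolded vector_derivative_works]
  show ?thesis
    unfolding fcov_eq[OF has_vector_derivative_add[OF d]]
    by (simp add: fcov_def vec_eq_iff forall_3 fconn_def algebra_simps)
qed

text \<open>Metric compatibility: the \<open>fconn\<close> terms cancel because
  \<open>fconn (t s)\<close> is skew with respect to \<open>fmetric\<close>.\<close>

lemma fmetric_has_real_derivative:
  assumes "u differentiable at s" "v differentiable at s"
  shows "((\<lambda>s. fmetric (u s) (v s)) has_real_derivative
    fmetric (fcov t u s) (v s) + fmetric (u s) (fcov t v s)) (at s)"
proof -
  note d = assms[unfolded vector_derivative_works, THEN has_vector_derivative_nth]
  show ?thesis
    unfolding fmetric_def
    by (rule derivative_eq_intros d refl)+ (simp add: fcov_def fconn_def algebra_simps)
qed

section \<open>Biharmonic curves in frame coordinates\<close>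

text \<open>The Frenet equations are kept for a later locale: translating them into
  \<open>fcov\<close> requires \<open>n\<close> and \<open>b\<close> to be differentiable, which is
  derived here first.\<close>

locale frenet_frame =
  fixes I :: "real set" and t n b :: "real \<Rightarrow> real^3" and k1 :: "real \<Rightarrow> real" and \<epsilon>1 \<epsilon>2 \<epsilon>3 :: real
  assumes open_I: "open I"
    and t_diff: "s \<in> I \<Longrightarrow> t differentiable at s"
    and a_diff: "s \<in> I \<Longrightarrow> fcov t t differentiable at s"
    and d_diff: "s \<in> I \<Longrightarrow> fcov t (fcov t t) differentiable at s"
    and eps: "\<epsilon>1 \<in> {1, -1}" "\<epsilon>2 \<in> {1, -1}" "\<epsilon>3 \<in> {1, -1}"
    and tt: "s \<in> I \<Longrightarrow> fmetric (t s) (t s) = \<epsilon>1"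
    and nn: "s \<in> I \<Longrightarrow> fmetric (n s) (n s) = \<epsilon>2"
    and bb: "s \<in> I \<Longrightarrow> fmetric (b s) (b s) = \<epsilon>3"
    and aa: "s \<in> I \<Longrightarrow> fmetric (fcov t t s) (fcov t t s) \<noteq> 0"
    and k1: "s \<in> I \<Longrightarrow> k1 s = sqrt \<bar>fmetric (fcov t t s) (fcov t t s)\<bar>"
    and a_eq: "s \<in> I \<Longrightarrow> fcov t t s = (k1 s * \<epsilon>2) *\<^sub>R n s"
    and b_eq: "s \<in> I \<Longrightarrow> b s = fwedge (t s) (n s)"
begin

abbreviation "a \<equiv> fcov t t"
abbreviation "d \<equiv> fcov t a"

lemma eps_sq: "\<epsilon>1 * \<epsilon>1 = 1" "\<epsilon>2 * \<epsilon>2 = 1" "\<epsilon>3 * \<epsilon>3 = 1"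
  using eps by auto

lemma k1_pos: "s \<in> I \<Longrightarrow> 0 < k1 s"
  using aa k1 by simp

text \<open>\<open>\<epsilon>2\<close> is the sign of \<open>fmetric (a s) (a s)\<close>, so it
  removes the absolute value, which is awkward to differentiate.\<close>

lemma k1_eq: "s \<in> I \<Longrightarrow> k1 s = sqrt (\<epsilon>2 * fmetric (a s) (a s))"
proof -
  assume s: "s \<in> I"
  have "fmetric (a s) (a s) = (k1 s)\<^sup>2 * \<epsilon>2"
    unfolding a_eq[OF s] by (simp add: fmetric_simps nn[OF s] eps_sq power2_eq_square)
  then show ?thesis
    using k1_pos[OF s] eps by (auto simp: real_sqrt_eq_iff)
qed

text \<open>The derivative of \<open>k1\<close>, in a closed form whose own differentiability
  follows from that of \<open>a\<close>, \<open>d\<close> and \<open>k1\<close>.\<close>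

definition "dk1 s = \<epsilon>2 * fmetric (d s) (a s) / k1 s"

lemma k1_has_derivative:
  assumes s: "s \<in> I"
  shows "(k1 has_real_derivative dk1 s) (at s)"
proof -
  have "0 < \<epsilon>2 * fmetric (a s) (a s)"
    using k1_pos[OF s] k1_eq[OF s] by simp
  then have "((\<lambda>s. sqrt (\<epsilon>2 * fmetric (a s) (a s))) has_real_derivative dk1 s) (at s)"
    unfolding dk1_def k1_eq[OF s]
    by (auto intro!: derivative_eq_intros fmetric_has_real_derivative[OF a_diff[OF s] a_diff[OF s], of t]
        simp: fmetric_sym[of "a s" "d s"] field_simps)
  then show ?thesis
    by (rule has_field_derivative_transform_within_open[OF _ open_I s]) (simp add: k1_eq)
qed

lemma k1_diff: "s \<in> I \<Longrightarrow> k1 differentiable at s"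
  using k1_has_derivative real_differentiable_def by blast

lemma dk1_diff: "s \<in> I \<Longrightarrow> dk1 differentiable at s"
  unfolding dk1_def[abs_def] using k1_pos
  by (intro differentiable_divide differentiable_mult differentiable_const fmetric_differentiable
      a_diff d_diff k1_diff) (simp_all add: less_imp_neq[THEN not_sym])

lemma n_diff:
  assumes s: "s \<in> I"
  shows "n differentiable at s"
proof (rule differentiable_cong_open[OF _ open_I s])
  show "(\<lambda>s. (\<epsilon>2 / k1 s) *\<^sub>R a s) differentiable at s"
    using k1_pos[OF s]
    by (intro differentiable_scaleR differentiable_divide differentiable_const a_diff k1_diff s) force
  show "(\<epsilon>2 / k1 s) *\<^sub>R a s = n s" if "s \<in> I" for s
    using k1_pos[OF that] eps_sq(2) by (simp add: a_eq[OF that])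
qed

lemma b_diff:
  assumes s: "s \<in> I"
  shows "b differentiable at s"
  by (rule differentiable_cong_open[OF fwedge_differentiable[OF t_diff[OF s] n_diff[OF s]] open_I s])
    (simp add: b_eq)

text \<open>Differentiating the constant speed makes \<open>a\<close> orthogonal to
  \<open>t\<close>, and \<open>n\<close> is proportional to \<open>a\<close>.\<close>

lemma tn:
  assumes s: "s \<in> I"
  shows "fmetric (t s) (n s) = 0"
proof -
  have "((\<lambda>s. fmetric (t s) (t s)) has_real_derivative 2 * fmetric (t s) (a s)) (at s)"
    using fmetric_has_real_derivative[OF t_diff[OF s] t_diff[OF s], of t]
    by (simp add: fmetric_sym[of "a s"])
  moreover have "((\<lambda>s. fmetric (t s) (t s)) has_real_derivative 0) (at s)"
    by (rule has_field_derivative_transform_within_open[OF DERIV_const open_I s]) (simp add: tt)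
  ultimately have "fmetric (t s) (a s) = 0"
    by (fastforce dest: DERIV_unique)
  then show ?thesis
    using k1_pos[OF s] eps_sq(2) by (auto simp: a_eq[OF s] fmetric_simps)
qed

lemma bt: "s \<in> I \<Longrightarrow> fmetric (b s) (t s) = 0" and bn: "s \<in> I \<Longrightarrow> fmetric (b s) (n s) = 0"
  by (simp_all add: b_eq fmetric_fwedge)

lemma eps3:
  assumes s: "s \<in> I"
  shows "\<epsilon>3 = \<epsilon>1 * \<epsilon>2"
  using bb[OF s] fmetric_fwedge_self[of "t s" "n s"] by (simp add: b_eq tt nn tn s)

text \<open>Up to sign this is the third component of \<open>fwedge (t s) (b s)\<close>, which is
  -\<epsilon>1 times \<open>n s\<close> by the triple product expansion.\<close>

lemma t_b_minor: "s \<in> I \<Longrightarrow> t s $ 2 * b s $ 1 - t s $ 1 * b s $ 2 = \<epsilon>1 * n s $ 3"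
proof -
  assume s: "s \<in> I"
  have "t s $ 2 * b s $ 1 - t s $ 1 * b s $ 2 =
      fmetric (t s) (t s) * n s $ 3 - fmetric (t s) (n s) * t s $ 3"
    by (simp add: b_eq[OF s] fwedge_def fmetric_def algebra_simps)
  then show ?thesis by (simp add: tt tn s)
qed

text \<open>The part of \<open>fcurv\<close> beyond the space form points in this direction. The
  vector is orthogonal to \<open>t\<close>, so its products with \<open>n\<close> and
  \<open>b\<close> determine it.\<close>

lemma reflection_t:
  assumes s: "s \<in> I"
  shows "vector [t s $ 2, t s $ 1, 0] = (- \<epsilon>2 * b s $ 3) *\<^sub>R n s + (\<epsilon>2 * n s $ 3) *\<^sub>R b s"
    (is "?w = ?r")
proof -
  have b3: "b s $ 3 = t s $ 1 * n s $ 2 - t s $ 2 * n s $ 1"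
    by (simp add: b_eq[OF s] fwedge_def)
  have nb: "fmetric (n s) (b s) = 0" "fmetric (n s) (t s) = 0"
    using bn tn s by (simp_all add: fmetric_sym)
  have w: "fmetric ?w (t s) = 0" "fmetric ?w (n s) = - b s $ 3" "fmetric ?w (b s) = \<epsilon>1 * n s $ 3"
    using t_b_minor[OF s] by (simp_all add: fmetric_def b3)
  have e: "\<epsilon>2 * (x * \<epsilon>2) = x" "\<epsilon>2 * (x * (\<epsilon>1 * \<epsilon>2)) = \<epsilon>1 * x" for x
    using eps_sq(2) by (simp_all add: algebra_simps)
  have "?w - ?r = 0"
  proof (rule fmetric_eq_zeroI[of _ "t s" "n s"])
    show "fmetric (fwedge (t s) (n s)) (fwedge (t s) (n s)) \<noteq> 0"
      using eps bb s by (auto simp: b_eq)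
    show "fmetric (?w - ?r) (fwedge (t s) (n s)) = 0"
      using w bb nb eps_sq eps3[OF s] s e by (simp add: fmetric_simps b_eq[OF s, symmetric] mult.assoc)
  qed (use w bb nb bt bn eps_sq e nn s in \<open>simp_all add: fmetric_simps mult.assoc\<close>)
  then show ?thesis by simp
qed

text \<open>The space form part gives -\<epsilon>1 times \<open>a s\<close>; the rest is a multiple
  of the vector in \<open>reflection_t\<close>.\<close>

lemma fcurv_t_a_t:
  assumes s: "s \<in> I"
  shows "fcurv (t s) (a s) (t s) =
    (- k1 s * (\<epsilon>1 * \<epsilon>2 + 4 * (b s $ 3)\<^sup>2)) *\<^sub>R n s + (4 * k1 s * n s $ 3 * b s $ 3) *\<^sub>R b s"
proof -
  have b3: "b s $ 3 = t s $ 1 * n s $ 2 - t s $ 2 * n s $ 1"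
    by (simp add: b_eq[OF s] fwedge_def)
  have e: "4 * (t s $ 1 * a s $ 2 - t s $ 2 * a s $ 1) = 4 * k1 s * \<epsilon>2 * b s $ 3"
    by (simp add: a_eq[OF s] b3 algebra_simps)
  have "fmetric (a s) (t s) = 0"
    by (simp add: a_eq fmetric_simps s tn fmetric_sym[of "n s"])
  then show ?thesis
    unfolding fcurv_def e reflection_t[OF s] tt[OF s]
    unfolding a_eq[OF s]
    using eps by (auto simp: vec_eq_iff algebra_simps power2_eq_square)
qed

end

section \<open>The bitension field in the Frenet frame\<close>

locale frenet_equations = frenet_frame +
  fixes k2 :: "real \<Rightarrow> real"
  assumes n': "s \<in> I \<Longrightarrow> fcov t n s = - (k1 s * \<epsilon>1) *\<^sub>R t s + (k2 s * \<epsilon>3) *\<^sub>R b s"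
    and b': "s \<in> I \<Longrightarrow> fcov t b s = - (k2 s * \<epsilon>2) *\<^sub>R n s"
begin

lemma d_eq:
  assumes s: "s \<in> I"
  shows "d s = (dk1 s * \<epsilon>2) *\<^sub>R n s + (- ((k1 s)\<^sup>2 * \<epsilon>1 * \<epsilon>2)) *\<^sub>R t s
    + (k1 s * k2 s * \<epsilon>2 * \<epsilon>3) *\<^sub>R b s"
proof -
  have "d s = fcov t (\<lambda>s. (k1 s * \<epsilon>2) *\<^sub>R n s) s"
    by (rule fcov_cong_open[OF open_I s]) (rule a_eq)
  also have "\<dots> = (dk1 s * \<epsilon>2) *\<^sub>R n s + (k1 s * \<epsilon>2) *\<^sub>R fcov t n s"
    by (rule fcov_scaleR) (auto intro!: derivative_eq_intros k1_has_derivative n_diff s)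
  finally show ?thesis
    by (simp add: n'[OF s] vec_eq_iff algebra_simps power2_eq_square)
qed

text \<open>\<open>k2\<close> is given only through the Frenet equations; pairing \<open>d\<close>
  with \<open>b\<close> expresses it by differentiable functions.\<close>

lemma k2_diff:
  assumes s: "s \<in> I"
  shows "k2 differentiable at s"
proof (rule differentiable_cong_open[OF _ open_I s])
  show "(\<lambda>s. \<epsilon>2 * fmetric (d s) (b s) / k1 s) differentiable at s"
    using k1_pos[OF s]
    by (intro differentiable_divide differentiable_mult differentiable_const fmetric_differentiable
        b_diff d_diff k1_diff s) force
  show "\<epsilon>2 * fmetric (d s) (b s) / k1 s = k2 s" if s: "s \<in> I" for s
    using k1_pos[OF s] eps bt[OF s] bn[OF s]
    by (auto simp: d_eq[OF s] fmetric_simps bb[OF s] fmetric_sym[of "n s" "b s"] fmetric_sym[of "t s" "b s"])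
qed

text \<open>Leibniz rule on \<open>d_eq\<close>: the coefficient 3 collects one term from
  \<open>fcov t n\<close> and two from differentiating the square of \<open>k1\<close>.\<close>

lemma fcov_d:
  assumes s: "s \<in> I"
  shows "fcov t d s = (- 3 * k1 s * dk1 s * \<epsilon>1 * \<epsilon>2) *\<^sub>R t s
    + (deriv dk1 s * \<epsilon>2 - (k1 s)^3 * \<epsilon>1 - k1 s * (k2 s)\<^sup>2 * \<epsilon>3) *\<^sub>R n s
    + ((2 * dk1 s * k2 s + k1 s * deriv k2 s) * \<epsilon>2 * \<epsilon>3) *\<^sub>R b s"
proof -
  note k1' = k1_has_derivative[OF s]
  have dk1': "(dk1 has_real_derivative deriv dk1 s) (at s)"
    using dk1_diff[OF s] by (simp add: DERIV_deriv_iff_real_differentiable)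
  have k2': "(k2 has_real_derivative deriv k2 s) (at s)"
    using k2_diff[OF s] by (simp add: DERIV_deriv_iff_real_differentiable)
  note diffs = k1_diff[OF s] dk1_diff[OF s] k2_diff[OF s] t_diff[OF s] n_diff[OF s] b_diff[OF s]
  have "fcov t d s = fcov t (\<lambda>s. (dk1 s * \<epsilon>2) *\<^sub>R n s + (- ((k1 s)\<^sup>2 * \<epsilon>1 * \<epsilon>2)) *\<^sub>R t s
    + (k1 s * k2 s * \<epsilon>2 * \<epsilon>3) *\<^sub>R b s) s"
    by (rule fcov_cong_open[OF open_I s]) (rule d_eq)
  also have "\<dots> = fcov t (\<lambda>s. (dk1 s * \<epsilon>2) *\<^sub>R n s) s
     + fcov t (\<lambda>s. (- ((k1 s)\<^sup>2 * \<epsilon>1 * \<epsilon>2)) *\<^sub>R t s) s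
     + fcov t (\<lambda>s. (k1 s * k2 s * \<epsilon>2 * \<epsilon>3) *\<^sub>R b s) s"
    by (subst fcov_add; (subst fcov_add)?)
      (intro differentiable_add differentiable_scaleR differentiable_mult differentiable_minus
        differentiable_power differentiable_const diffs | simp)+
  also have "fcov t (\<lambda>s. (dk1 s * \<epsilon>2) *\<^sub>R n s) s =
      (deriv dk1 s * \<epsilon>2) *\<^sub>R n s + (dk1 s * \<epsilon>2) *\<^sub>R fcov t n s"
    by (rule fcov_scaleR) (auto intro!: derivative_eq_intros dk1' diffs)
  also have "fcov t (\<lambda>s. (- ((k1 s)\<^sup>2 * \<epsilon>1 * \<epsilon>2)) *\<^sub>R t s) s =
      (- (2 * k1 s * dk1 s * \<epsilon>1 * \<epsilon>2)) *\<^sub>R t s + (- ((k1 s)\<^sup>2 * \<epsilon>1 * \<epsilon>2)) *\<^sub>R a s"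
    by (rule fcov_scaleR) (auto intro!: derivative_eq_intros k1' diffs)
  also have "fcov t (\<lambda>s. (k1 s * k2 s * \<epsilon>2 * \<epsilon>3) *\<^sub>R b s) s =
      ((dk1 s * k2 s + k1 s * deriv k2 s) * \<epsilon>2 * \<epsilon>3) *\<^sub>R b s
      + (k1 s * k2 s * \<epsilon>2 * \<epsilon>3) *\<^sub>R fcov t b s"
    by (rule fcov_scaleR) (auto intro!: derivative_eq_intros k1' k2' diffs simp: algebra_simps)
  finally show ?thesis
    unfolding n'[OF s] b'[OF s] a_eq[OF s]
    using eps by (auto simp: vec_eq_iff algebra_simps power2_eq_square power3_eq_cube)
qed

text \<open>At a single point \<open>dk1 s = 0\<close> says nothing about
  \<open>deriv dk1 s\<close>, so that term stays until all points are considered together.\<close>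

lemma bitension_zero_iff:
  assumes s: "s \<in> I"
  shows "fcov t d s - fcurv (t s) (a s) (t s) = 0 \<longleftrightarrow> dk1 s = 0 \<and>
    deriv dk1 s * \<epsilon>2 + k1 s * (\<epsilon>1 * \<epsilon>2 + 4 * (b s $ 3)\<^sup>2 - (k1 s)\<^sup>2 * \<epsilon>1 - (k2 s)\<^sup>2 * \<epsilon>3) = 0 \<and>
    deriv k2 s = 4 * \<epsilon>1 * n s $ 3 * b s $ 3"
proof -
  define \<alpha> \<beta> \<delta> where "\<alpha> = - 3 * k1 s * dk1 s * \<epsilon>1 * \<epsilon>2"
    and "\<beta> = deriv dk1 s * \<epsilon>2 + k1 s * (\<epsilon>1 * \<epsilon>2 + 4 * (b s $ 3)\<^sup>2 - (k1 s)\<^sup>2 * \<epsilon>1 - (k2 s)\<^sup>2 * \<epsilon>3)"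
    and "\<delta> = (2 * dk1 s * k2 s + k1 s * deriv k2 s) * \<epsilon>2 * \<epsilon>3 - 4 * k1 s * n s $ 3 * b s $ 3"
  have eq: "fcov t d s - fcurv (t s) (a s) (t s) = \<alpha> *\<^sub>R t s + \<beta> *\<^sub>R n s + \<delta> *\<^sub>R b s"
    unfolding fcov_d[OF s] fcurv_t_a_t[OF s] \<alpha>_def \<beta>_def \<delta>_def
    by (simp add: vec_eq_iff algebra_simps power2_eq_square power3_eq_cube)
  have "\<alpha> *\<^sub>R t s + \<beta> *\<^sub>R n s + \<delta> *\<^sub>R b s = 0 \<longleftrightarrow> \<alpha> = 0 \<and> \<beta> = 0 \<and> \<delta> = 0" (is "?v = 0 \<longleftrightarrow> _")
  proof
    assume v: "?v = 0"
    have "fmetric ?v w = 0" for w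
      unfolding v by (rule fmetric_simps)
    from this[of "t s"] this[of "n s"] this[of "b s"] show "\<alpha> = 0 \<and> \<beta> = 0 \<and> \<delta> = 0"
      using tt nn bb tn bt bn s eps
      by (auto simp: fmetric_simps fmetric_sym[of "n s" "t s"] fmetric_sym[of "n s" "b s"]
          fmetric_sym[of "t s" "b s"])
  qed simp
  moreover have "\<alpha> = 0 \<longleftrightarrow> dk1 s = 0"
    using k1_pos[OF s] eps unfolding \<alpha>_def by auto
  \<comment> \<open>The binormal coefficient contains a multiple of \<open>dk1 s * k2 s\<close>, so
    the tangential equation is used first.\<close>
  moreover have "\<delta> = 0 \<longleftrightarrow> deriv k2 s = 4 * \<epsilon>1 * n s $ 3 * b s $ 3" if "dk1 s = 0"
  proof -
    have "\<delta> = k1 s * (\<epsilon>1 * deriv k2 s - 4 * n s $ 3 * b s $ 3)"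
      unfolding \<delta>_def that eps3[OF s] using eps_sq by (simp add: algebra_simps)
    then show ?thesis
      using k1_pos[OF s] eps by auto
  qed
  ultimately show ?thesis
    unfolding eq \<beta>_def[symmetric] by blast
qed

section \<open>From the bitension equations to the invariants\<close>

lemma b3_has_derivative:
  assumes s: "s \<in> I"
  shows "((\<lambda>s. b s $ 3) has_real_derivative n s $ 3 * (\<epsilon>1 - \<epsilon>2 * k2 s)) (at s)"
proof -
  have "(b has_vector_derivative vector_derivative b (at s)) (at s)"
    using b_diff[OF s] by (simp add: vector_derivative_works)
  \<comment> \<open>Third component of the Frenet equation for \<open>b\<close>; the
    \<open>fconn\<close> term is the minor of \<open>t_b_minor\<close>.\<close>
  moreover have "vector_derivative b (at s) $ 3 = n s $ 3 * (\<epsilon>1 - \<epsilon>2 * k2 s)"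
    using arg_cong[OF b'[OF s], of "\<lambda>v. v $ 3"] t_b_minor[OF s]
    by (simp add: fcov_def fconn_def algebra_simps)
  ultimately show ?thesis
    by (metis has_vector_derivative_nth)
qed

text \<open>Used with \<open>m = 4 * \<epsilon>1\<close>, the factor in the bitension equation, and with \<open>m = 1\<close>, the factor in
  the theorem.\<close>

lemma n3_b3_eq_0:
  assumes k1: "\<And>s. s \<in> I \<Longrightarrow> k1 s = k"
    and k2: "\<And>s. s \<in> I \<Longrightarrow> (k1 s)\<^sup>2 * \<epsilon>1 * \<epsilon>3 + (k2 s)\<^sup>2 = 1 + 4 * \<epsilon>3 * (b s $ 3)\<^sup>2"
    and k2': "\<And>s. s \<in> I \<Longrightarrow> (k2 has_real_derivative m * (n s $ 3 * b s $ 3)) (at s)"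
    and m: "m \<noteq> 0" "m + 4 * \<epsilon>1 \<noteq> 0"
    and s: "s \<in> I"
  shows "n s $ 3 * b s $ 3 = 0"
proof (rule ccontr)
  have first: "n s $ 3 * b s $ 3 * ((m + 4 * \<epsilon>1) * k2 s - 4 * \<epsilon>2) = 0" if s: "s \<in> I" for s
  proof -
    have "((\<lambda>s. (k2 s)\<^sup>2 - 4 * \<epsilon>3 * (b s $ 3)\<^sup>2) has_real_derivative
      2 * k2 s * (m * (n s $ 3 * b s $ 3)) - 8 * \<epsilon>3 * b s $ 3 * (n s $ 3 * (\<epsilon>1 - \<epsilon>2 * k2 s))) (at s)"
      by (auto intro!: derivative_eq_intros k2' b3_has_derivative s)
    \<comment> \<open>With \<open>k1\<close> constant, the second condition makes this combination
      constant on \<open>I\<close>.\<close>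
    moreover have "((\<lambda>s. (k2 s)\<^sup>2 - 4 * \<epsilon>3 * (b s $ 3)\<^sup>2) has_real_derivative 0) (at s)"
      by (rule has_field_derivative_transform_within_open[OF DERIV_const[of "1 - k\<^sup>2 * \<epsilon>1 * \<epsilon>3"] open_I s])
        (use k2 k1 in \<open>simp add: algebra_simps\<close>)
    ultimately have
      "2 * k2 s * (m * (n s $ 3 * b s $ 3)) - 8 * \<epsilon>3 * b s $ 3 * (n s $ 3 * (\<epsilon>1 - \<epsilon>2 * k2 s)) = 0"
      by (rule DERIV_unique)
    then show ?thesis
      using eps unfolding eps3[OF s] by (auto simp: algebra_simps)
  qed
  assume "n s $ 3 * b s $ 3 \<noteq> 0"
  \<comment> \<open>Openness of \<open>J\<close> turns the constancy of \<open>k2\<close> on it into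
    a zero derivative at \<open>s\<close>.\<close>
  define J where "J = {x \<in> I. n x $ 3 * b x $ 3 \<noteq> 0}"
  have "continuous_on I (\<lambda>x. n x $ 3 * b x $ 3)"
    by (intro continuous_at_imp_continuous_on ballI differentiable_imp_continuous_within
        differentiable_mult differentiable_nth n_diff b_diff)
  then have "open (I \<inter> (\<lambda>x. n x $ 3 * b x $ 3) -` (- {0}))"
    using open_I by (rule continuous_open_preimage) auto
  moreover have "J = I \<inter> (\<lambda>x. n x $ 3 * b x $ 3) -` (- {0})"
    by (auto simp: J_def)
  ultimately have J: "open J" by simp
  have sJ: "s \<in> J"
    using s \<open>n s $ 3 * b s $ 3 \<noteq> 0\<close> by (simp add: J_def)
  have "4 * \<epsilon>2 / (m + 4 * \<epsilon>1) = k2 x" if "x \<in> J" for x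
  proof -
    have "(m + 4 * \<epsilon>1) * k2 x = 4 * \<epsilon>2"
      using first[of x] that by (auto simp: J_def)
    then show ?thesis using m by (simp add: field_simps)
  qed
  then have "(k2 has_real_derivative 0) (at s)"
    using has_field_derivative_transform_within_open[OF DERIV_const J sJ] by blast
  then have "m * (n s $ 3 * b s $ 3) = 0"
    using k2'[OF s] by (metis DERIV_unique)
  with m \<open>n s $ 3 * b s $ 3 \<noteq> 0\<close> show False by simp
qed

theorem bitension_zero_iff_invariants:
  assumes I: "is_interval I"
  shows "(\<forall>s\<in>I. fcov t d s - fcurv (t s) (a s) (t s) = 0) \<longleftrightarrow>
    (\<exists>k. k \<noteq> 0 \<and> (\<forall>s\<in>I. k1 s = k)) \<and>
    (\<forall>s\<in>I. (k1 s)\<^sup>2 * \<epsilon>1 * \<epsilon>3 + (k2 s)\<^sup>2 = 1 + 4 * \<epsilon>3 * (b s $ 3)\<^sup>2) \<and>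
    (\<forall>s\<in>I. (k2 has_real_derivative n s $ 3 * b s $ 3) (at s))"
    (is "?bih \<longleftrightarrow> ?c1 \<and> ?c2 \<and> ?c3")
proof -
  have deriv_dk1: "deriv dk1 s = 0" if "\<forall>s\<in>I. dk1 s = 0" "s \<in> I" for s
  proof (rule DERIV_imp_deriv)
    show "(dk1 has_real_derivative 0) (at s)"
      by (rule has_field_derivative_transform_within_open[OF DERIV_const open_I \<open>s \<in> I\<close>])
        (use that in simp)
  qed
  \<comment> \<open>Multiplication by \<epsilon>3 = \<epsilon>1 \<epsilon>2 turns one equation into
    the other.\<close>
  have c2_iff: "\<epsilon>1 * \<epsilon>2 + 4 * (b s $ 3)\<^sup>2 - (k1 s)\<^sup>2 * \<epsilon>1 - (k2 s)\<^sup>2 * \<epsilon>3 = 0 \<longleftrightarrow>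
      (k1 s)\<^sup>2 * \<epsilon>1 * \<epsilon>3 + (k2 s)\<^sup>2 = 1 + 4 * \<epsilon>3 * (b s $ 3)\<^sup>2" if s: "s \<in> I" for s
    using eps unfolding eps3[OF s] by (auto simp: algebra_simps)
  \<comment> \<open>The side conditions of \<open>n3_b3_eq_0\<close> for
    \<open>m = 4 * \<epsilon>1\<close> and \<open>m = 1\<close>; the last sum is 5 or -3.\<close>
  have m: "4 * \<epsilon>1 \<noteq> 0" "4 * \<epsilon>1 + 4 * \<epsilon>1 \<noteq> 0" "1 + 4 * \<epsilon>1 \<noteq> 0"
    using eps by auto
  show ?thesis
  proof
    assume ?bih
    then have z: "dk1 s = 0"
      "deriv dk1 s * \<epsilon>2 + k1 s * (\<epsilon>1 * \<epsilon>2 + 4 * (b s $ 3)\<^sup>2 - (k1 s)\<^sup>2 * \<epsilon>1 - (k2 s)\<^sup>2 * \<epsilon>3) = 0"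
      "deriv k2 s = 4 * \<epsilon>1 * n s $ 3 * b s $ 3" if "s \<in> I" for s
      using bitension_zero_iff that by blast+
    \<comment> \<open>Here connectedness of the interval turns a zero derivative into a
      constant.\<close>
    have "\<exists>k. \<forall>s\<in>I. k1 s = k"
      using has_field_derivative_zero_constant[of I k1] k1_has_derivative z(1) I
      by (metis has_field_derivative_at_within is_interval_convex)
    then obtain k where k: "\<forall>s\<in>I. k1 s = k" by blast
    have ?c1
    \<comment> \<open>On the empty set \<open>k1_pos\<close> yields no nonzero value, so the
      constant 1 is supplied.\<close>
    proof (cases "I = {}")
      case False
      then show ?thesis using k k1_pos by (metis all_not_in_conv less_irrefl)
    qed (auto intro: exI[of _ 1])
    moreover have c2: ?c2
    proof
      fix s assume s: "s \<in> I"
      then show "(k1 s)\<^sup>2 * \<epsilon>1 * \<epsilon>3 + (k2 s)\<^sup>2 = 1 + 4 * \<epsilon>3 * (b s $ 3)\<^sup>2"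
        using z(2)[OF s] deriv_dk1 z(1) k1_pos[OF s] c2_iff[OF s] by simp
    qed
    moreover have k2': "(k2 has_real_derivative 4 * \<epsilon>1 * (n s $ 3 * b s $ 3)) (at s)" if "s \<in> I" for s
      using k2_diff[OF that] z(3)[OF that] DERIV_deriv_iff_real_differentiable[of k2 s]
      by (simp add: mult.assoc)
    have ?c3
    proof
      fix s assume s: "s \<in> I"
      \<comment> \<open>Once the product is zero, the factors \<open>4 * \<epsilon>1\<close> and 1
        give the same equation for the derivative of \<open>k2\<close>.\<close>
      have nb: "n s $ 3 * b s $ 3 = 0"
        using n3_b3_eq_0[of k "4 * \<epsilon>1" s] k c2 k2' m s by blast
      show "(k2 has_real_derivative n s $ 3 * b s $ 3) (at s)"
        using k2'[OF s] unfolding nb by simp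
    qed
    ultimately show "?c1 \<and> ?c2 \<and> ?c3" by blast
  next
    assume c: "?c1 \<and> ?c2 \<and> ?c3"
    then obtain k where k: "\<And>s. s \<in> I \<Longrightarrow> k1 s = k" by blast
    have dk1: "dk1 s = 0" if s: "s \<in> I" for s
      by (rule DERIV_unique[OF k1_has_derivative[OF s]],
          rule has_field_derivative_transform_within_open[OF DERIV_const open_I s]) (simp add: k)
    show ?bih
    proof
      fix s assume s: "s \<in> I"
      have "n s $ 3 * b s $ 3 = 0"
        using n3_b3_eq_0[of k 1 s] k c m s by simp
      moreover from this have "deriv k2 s = 0"
        using c s by (metis DERIV_imp_deriv)
      ultimately show "fcov t d s - fcurv (t s) (a s) (t s) = 0"
        unfolding bitension_zero_iff[OF s]
        using dk1 deriv_dk1 s c2_iff[OF s] c by simp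
    qed
  qed
qed

end

section \<open>Transfer to the hyperbolic Heisenberg group\<close>

lemma smooth_curve_has_vector_derivative:
  assumes "smooth_curve_on I c" "s \<in> I"
  shows "((velocity ^^ m) c has_vector_derivative (velocity ^^ Suc m) c s) (at s)"
  using assms by (simp add: smooth_curve_on_def velocity_def vector_derivative_works)

text \<open>\<open>fcov\<close> is a total operator, so regularity has to be proved: each field is
  equated on \<open>I\<close> with an explicit expression in the derivatives of the curve.\<close>

lemma smooth_curve_frame_regularity:
  fixes c :: "real \<Rightarrow> real^3"
  defines "t \<equiv> \<lambda>s. frame_coords (c s) (velocity c s)"
  assumes I: "open I" and c: "smooth_curve_on I c" and s: "s \<in> I"
  shows "t differentiable at s" "fcov t t differentiable at s" "fcov t (fcov t t) differentiable at s"
proof -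
  define v where "v m = (velocity ^^ m) c" for m
  define F where "F m s = frame_coords (c s) (v m s)" for m s
  \<comment> \<open>The correction from the moving frame when \<open>F m\<close> is
    differentiated.\<close>
  define r where "r m s = (vector [0, 0, v 1 s $ 2 * v m s $ 1 - v 1 s $ 1 * v m s $ 2] :: real^3)" for m s
  have v': "(v m has_vector_derivative v (Suc m) s) (at s)" if "s \<in> I" for m s
    unfolding v_def using c that by (rule smooth_curve_has_vector_derivative)
  then have v_diff: "v m differentiable at s" if "s \<in> I" for m s
    using that differentiableI_vector by blast
  have c0: "c = v 0" "t = F 1"
    by (simp_all add: t_def F_def v_def fun_eq_iff)
  have F': "(F m has_vector_derivative F (Suc m) s + r m s) (at s)" if "s \<in> I" for m s
    unfolding F_def r_def using v'[OF that, of 0] v'[OF that, of m]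
    by (simp add: c0 frame_coords_has_vector_derivative)
  then have F_diff: "F m differentiable at s" if "s \<in> I" for m s
    using that differentiableI_vector by blast
  have r_diff: "r m differentiable at s" if "s \<in> I" for m s
    unfolding r_def using v_diff[OF that, THEN differentiable_nth]
    by (intro differentiable_vector_3 differentiable_const differentiable_diff differentiable_mult)
  \<comment> \<open>For the velocity itself the correction cancels by antisymmetry.\<close>
  have r1: "r 1 s = 0" for s
    by (simp add: r_def vec_eq_iff forall_3)
  have t': "(t has_vector_derivative F 2 s) (at s)" if "s \<in> I" for s
    using F'[OF that, of 1] r1[of s] by (simp add: c0 numeral_2_eq_2)
  note fconn' = bounded_bilinear.has_vector_derivative[OF bounded_bilinear_fconn]
  have fconn_diff: "(\<lambda>s. fconn (u s) (w s)) differentiable at s"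
    if "u differentiable at s" "w differentiable at s" for u w :: "real \<Rightarrow> real^3" and s
    using differentiableI_vector[OF fconn'[OF that[unfolded vector_derivative_works]]] .
  have a: "F 2 s + fconn (t s) (t s) = fcov t t s" if "s \<in> I" for s
    using fcov_eq[OF t'[OF that]] by simp
  show t_diff: "t differentiable at s"
    using F_diff[OF s] by (simp add: c0)
  have "(\<lambda>s. F 2 s + fconn (t s) (t s)) differentiable at s"
    by (intro differentiable_add F_diff fconn_diff t_diff s)
  then show a_diff: "fcov t t differentiable at s"
    using I s a by (rule differentiable_cong_open)
  \<comment> \<open>Differentiating \<open>F 2\<close> brings in \<open>r 2\<close>, which, unlike
    \<open>r 1\<close>, need not vanish.\<close>
  have d: "F 3 s + r 2 s + (fconn (t s) (F 2 s) + fconn (F 2 s) (t s)) + fconn (t s) (fcov t t s)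
      = fcov t (fcov t t) s" if "s \<in> I" for s
  proof -
    have "((\<lambda>s. F 2 s + fconn (t s) (t s)) has_vector_derivative
        F 3 s + r 2 s + (fconn (t s) (F 2 s) + fconn (F 2 s) (t s))) (at s)"
      using F'[OF that, of 2] by (intro has_vector_derivative_add fconn' t' that) (simp add: eval_nat_numeral)
    then have "(fcov t t has_vector_derivative
        F 3 s + r 2 s + (fconn (t s) (F 2 s) + fconn (F 2 s) (t s))) (at s)"
      using I that a by (rule has_vector_derivative_transform_within_open)
    then show ?thesis by (simp add: fcov_eq)
  qed
  have "(\<lambda>s. F 3 s + r 2 s + (fconn (t s) (F 2 s) + fconn (F 2 s) (t s)) + fconn (t s) (fcov t t s))
      differentiable at s"
    by (intro differentiable_add F_diff r_diff fconn_diff t_diff a_diff s)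
  then show "fcov t (fcov t t) differentiable at s"
    using I s d by (rule differentiable_cong_open)
qed

theorem theorem3p1:
  fixes I :: "real set" and \<gamma> N B :: "real \<Rightarrow> real^3"
    and k1 k2 :: "real \<Rightarrow> real" and \<epsilon>1 \<epsilon>2 \<epsilon>3 :: real
  assumes "open I" and "is_interval I"
    and "nonnull_arclength_curve I \<gamma> \<epsilon>1"
    and "frenet_apparatus I \<gamma> \<epsilon>1 \<epsilon>2 \<epsilon>3 k1 k2 N B"
  shows "nongeodesic_on hh3 I \<gamma> \<and> biharmonic_on hh3 I \<gamma> \<longleftrightarrow>
    (\<exists>k. k \<noteq> 0 \<and> (\<forall>s\<in>I. k1 s = k)) \<and>
    (\<forall>s\<in>I. (k1 s)\<^sup>2 * \<epsilon>1 * \<epsilon>3 + (k2 s)\<^sup>2 = 1 + 4 * \<epsilon>3 * (frame_coords (\<gamma> s) (B s) $ 3)\<^sup>2) \<and>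
    (\<forall>s\<in>I. (k2 has_real_derivative
        frame_coords (\<gamma> s) (N s) $ 3 * frame_coords (\<gamma> s) (B s) $ 3) (at s))"
proof -
  define t n b where "t s = frame_coords (\<gamma> s) (velocity \<gamma> s)"
    and "n s = frame_coords (\<gamma> s) (N s)" and "b s = frame_coords (\<gamma> s) (B s)" for s
  define A where "A = cov_deriv hh3 \<gamma> (velocity \<gamma>)"
  have smooth: "smooth_curve_on I \<gamma>" and eps1: "\<epsilon>1 \<in> {1, -1}"
    and speed: "\<And>s. s \<in> I \<Longrightarrow> hh3 (\<gamma> s) (velocity \<gamma> s) (velocity \<gamma> s) = \<epsilon>1"
    using assms(3) by (auto simp: nonnull_arclength_curve_def)
  have eps23: "\<epsilon>2 \<in> {1, -1}" "\<epsilon>3 \<in> {1, -1}"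
    and fr: "\<And>s. s \<in> I \<Longrightarrow> A s \<noteq> 0 \<and> hh3 (\<gamma> s) (A s) (A s) \<noteq> 0 \<and>
          k1 s = sqrt \<bar>hh3 (\<gamma> s) (A s) (A s)\<bar> \<and> hh3 (\<gamma> s) (N s) (N s) = \<epsilon>2 \<and>
          A s = (k1 s * \<epsilon>2) *\<^sub>R N s \<and> B s = wedge (\<gamma> s) (velocity \<gamma> s) (N s) \<and>
          hh3 (\<gamma> s) (B s) (B s) = \<epsilon>3 \<and>
          cov_deriv hh3 \<gamma> N s = - (k1 s * \<epsilon>1) *\<^sub>R velocity \<gamma> s + (k2 s * \<epsilon>3) *\<^sub>R B s \<and>
          cov_deriv hh3 \<gamma> B s = - (k2 s * \<epsilon>2) *\<^sub>R N s"
    using assms(4) unfolding frenet_apparatus_def Let_def A_def by blast+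
  have A0: "\<And>s. s \<in> I \<Longrightarrow> A s \<noteq> 0"
    and AA: "\<And>s. s \<in> I \<Longrightarrow> hh3 (\<gamma> s) (A s) (A s) \<noteq> 0"
    and k1: "\<And>s. s \<in> I \<Longrightarrow> k1 s = sqrt \<bar>hh3 (\<gamma> s) (A s) (A s)\<bar>"
    and NN: "\<And>s. s \<in> I \<Longrightarrow> hh3 (\<gamma> s) (N s) (N s) = \<epsilon>2"
    and A: "\<And>s. s \<in> I \<Longrightarrow> A s = (k1 s * \<epsilon>2) *\<^sub>R N s"
    and B: "\<And>s. s \<in> I \<Longrightarrow> B s = wedge (\<gamma> s) (velocity \<gamma> s) (N s)"
    and BB: "\<And>s. s \<in> I \<Longrightarrow> hh3 (\<gamma> s) (B s) (B s) = \<epsilon>3"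
    and N': "\<And>s. s \<in> I \<Longrightarrow>
      cov_deriv hh3 \<gamma> N s = - (k1 s * \<epsilon>1) *\<^sub>R velocity \<gamma> s + (k2 s * \<epsilon>3) *\<^sub>R B s"
    and B': "\<And>s. s \<in> I \<Longrightarrow> cov_deriv hh3 \<gamma> B s = - (k2 s * \<epsilon>2) *\<^sub>R N s"
    by (drule fr, elim conjE, assumption)+
  have t_eq: "t = (\<lambda>s. frame_coords (\<gamma> s) (velocity \<gamma> s))"
    by (simp add: t_def fun_eq_iff)
  have \<gamma>_diff: "\<gamma> differentiable at s" if "s \<in> I" for s
    using smooth_curve_has_vector_derivative[OF smooth that, of 0] by (auto intro: differentiableI_vector)
  note reg = smooth_curve_frame_regularity[OF assms(1) smooth, folded t_eq]
  note cov = frame_coords_cov_deriv_cong[OF assms(1) _ \<gamma>_diff, folded t_eq]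
  note lin = linear_add[OF frame_coords_linear] linear_scale[OF frame_coords_linear]
    linear_diff[OF frame_coords_linear] linear_0[OF frame_coords_linear]
  have a: "frame_coords (\<gamma> s) (A s) = fcov t t s" if "s \<in> I" for s
    unfolding A_def by (rule cov) (simp_all add: that reg t_def)
  interpret frenet_frame I t n b k1 \<epsilon>1 \<epsilon>2 \<epsilon>3
  proof
    fix s assume s: "s \<in> I"
    show "fmetric (t s) (t s) = \<epsilon>1"
      unfolding t_def using speed[OF s] by (simp only: hh3_frame)
    show "fmetric (n s) (n s) = \<epsilon>2" "fmetric (b s) (b s) = \<epsilon>3"
      unfolding n_def b_def hh3_frame[symmetric] using NN[OF s] BB[OF s] .
    show "fmetric (fcov t t s) (fcov t t s) \<noteq> 0" "k1 s = sqrt \<bar>fmetric (fcov t t s) (fcov t t s)\<bar>"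
      unfolding a[OF s, symmetric] hh3_frame[symmetric] using AA[OF s] k1[OF s] .
    show "fcov t t s = (k1 s * \<epsilon>2) *\<^sub>R n s"
      unfolding a[OF s, symmetric] n_def A[OF s] lin ..
    show "b s = fwedge (t s) (n s)"
      unfolding b_def t_def n_def B[OF s] frame_coords_wedge ..
  qed (use assms(1) eps1 eps23 reg in auto)
  \<comment> \<open>\<open>n_diff\<close> and \<open>b_diff\<close> from the first interpretation
    make the transfer rule \<open>cov\<close> applicable to \<open>N\<close> and
    \<open>B\<close>.\<close>
  interpret frenet_equations I t n b k1 \<epsilon>1 \<epsilon>2 \<epsilon>3 k2
  proof
    fix s assume s: "s \<in> I"
    have "frame_coords (\<gamma> s) (cov_deriv hh3 \<gamma> N s) = fcov t n s"
      by (rule cov) (simp_all only: s n_diff n_def)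
    then show "fcov t n s = - (k1 s * \<epsilon>1) *\<^sub>R t s + (k2 s * \<epsilon>3) *\<^sub>R b s"
      unfolding N'[OF s] lin t_def b_def by (rule sym)
    have "frame_coords (\<gamma> s) (cov_deriv hh3 \<gamma> B s) = fcov t b s"
      by (rule cov) (simp_all only: s b_diff b_def)
    then show "fcov t b s = - (k2 s * \<epsilon>2) *\<^sub>R n s"
      unfolding B'[OF s] lin n_def by (rule sym)
  qed
  have d: "frame_coords (\<gamma> s) (cov_deriv hh3 \<gamma> A s) = fcov t (fcov t t) s" if "s \<in> I" for s
    by (rule cov) (simp_all only: that reg a)
  have "frame_coords (\<gamma> s) (cov_deriv hh3 \<gamma> (cov_deriv hh3 \<gamma> A) s) =
      fcov t (fcov t (fcov t t)) s" if "s \<in> I" for s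
    by (rule cov) (simp_all only: that reg d)
  then have "frame_coords (\<gamma> s) (cov_deriv hh3 \<gamma> (cov_deriv hh3 \<gamma> A) s
       - curvature hh3 (\<gamma> s) (velocity \<gamma> s) (A s) (velocity \<gamma> s)) =
      fcov t (fcov t (fcov t t)) s - fcurv (t s) (fcov t t s) (t s)" if "s \<in> I" for s
    unfolding lin frame_coords_curvature using that by (simp only: a t_def)
  \<comment> \<open>Frame components determine a vector, so the bitension field vanishes exactly
    when its components do.\<close>
  then have bitension: "cov_deriv hh3 \<gamma> (cov_deriv hh3 \<gamma> A) s
       - curvature hh3 (\<gamma> s) (velocity \<gamma> s) (A s) (velocity \<gamma> s) = 0 \<longleftrightarrow>
      fcov t (fcov t (fcov t t)) s - fcurv (t s) (fcov t t s) (t s) = 0" if "s \<in> I" for s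
    using that by (metis frame_coords_inject lin(4))
  have "nongeodesic_on hh3 I \<gamma>"
    using A0 unfolding nongeodesic_on_def A_def by blast
  then have "nongeodesic_on hh3 I \<gamma> \<and> biharmonic_on hh3 I \<gamma> \<longleftrightarrow>
      (\<forall>s\<in>I. fcov t (fcov t (fcov t t)) s - fcurv (t s) (fcov t t s) (t s) = 0)"
    using bitension unfolding biharmonic_on_def A_def by blast
  then show ?thesis
    unfolding bitension_zero_iff_invariants[OF assms(2)] n_def b_def .
qed

end
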